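(* Let $n \ge 1$, let $1 \le p < \infty$, let $e_1, \dots, e_n$ be an orthonormal basis of $\mathbb{C}^n$, and let $A \in M_n(\mathbb{C})$ be a normal matrix. Put $b_p = \max_{0 \le t \le 1} \bigl(t^p(1-t) + t(1-t)^p\bigr)$. Then $$\left(\frac{1}{n}\sum_{i=1}^n \Bigl|\langle Ae_i, e_i\rangle - \frac{1}{n}\sum_{j=1}^n \langle Ae_j, e_j\rangle\Bigr|^p\right)^{1/p} \;\le\; \frac{2}{\sqrt{3}}\, b_p^{1/p}\,\mathrm{spd}(A).$$ Moreover, if $A$ is Hermitian, then $$\left(\frac{1}{n}\sum_{i=1}^n \Bigl|\langle Ae_i, e_i\rangle - \frac{1}{n}\sum_{j=1}^n \langle Ae_j, e_j\rangle\Bigr|^p\right)^{1/p} \;\le\; b_p^{1/p}\,\mathrm{spd}(A).$$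
   Context: $M_n(\mathbb{C})$ is the algebra of $n\times n$ complex matrices, and $\langle\cdot,\cdot\rangle$ is the standard inner product on $\mathbb{C}^n$. The spread of $A$ is $\mathrm{spd}(A) = \max_{i,j} |\lambda_i(A) - \lambda_j(A)|$, where $\lambda_1(A),\dots,\lambda_n(A)$ are the eigenvalues of $A$. The number $b_p$ is the largest $p$-th central moment $\mathbb{E}|X-\mathbb{E}X|^p$ of a Bernoulli random variable $X$ with values in $\{0,1\}$. *)

theory Defs
  imports
    Complex_Main
    "Jordan_Normal_Form.Schur_Decomposition"
    "Jordan_Normal_Form.Spectral_Radius"
begin

definition normal_mat :: "complex mat \<Rightarrow> bool" where
  "normal_mat A \<longleftrightarrow> mat_adjoint A * A = A * mat_adjoint A"

definition hermitian_mat :: "complex mat \<Rightarrow> bool" where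
  "hermitian_mat A \<longleftrightarrow> mat_adjoint A = A"

definition orthonormal_basis :: "nat \<Rightarrow> (nat \<Rightarrow> complex vec) \<Rightarrow> bool" where
  "orthonormal_basis n e \<longleftrightarrow>
     vectorspace.basis class_ring (module_vec TYPE(complex) n) (e ` {..<n}) \<and>
     (\<forall>i<n. \<forall>j<n. e i \<bullet>c e j = (if i = j then 1 else 0))"

definition spread :: "complex mat \<Rightarrow> real" where
  "spread A = Max {cmod (x - y) | x y. x \<in> spectrum A \<and> y \<in> spectrum A}"

text \<open>The supremum is attained for \<open>p > 0\<close>, see \<open>bernoulli_moment_max_attained\<close>. Since
  \<open>0 powr p = 0\<close>, the formula is also the intended one at the endpoints.\<close>

definition bernoulli_moment_max :: "real \<Rightarrow> real" where
  "bernoulli_moment_max p = (SUP t\<in>{0..1}. t powr p * (1 - t) + t * (1 - t) powr p)"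

lemma bernoulli_moment_max_attained:
  assumes "p > 0"
  shows "\<exists>t\<in>{0..1}. bernoulli_moment_max p = t powr p * (1 - t) + t * (1 - t) powr p \<and>
    (\<forall>s\<in>{0..1}. s powr p * (1 - s) + s * (1 - s) powr p \<le> bernoulli_moment_max p)"
proof -
  let ?f = "\<lambda>t::real. t powr p * (1 - t) + t * (1 - t) powr p"
  have "continuous_on {0..1} ?f"
    using assms by (intro continuous_intros continuous_on_powr') auto
  then obtain t where t: "t \<in> {0..1}" "\<forall>s\<in>{0..1}. ?f s \<le> ?f t"
    using continuous_attains_sup[of "{0..1::real}" ?f] by auto
  then have "bernoulli_moment_max p = ?f t"
    unfolding bernoulli_moment_max_def by (intro cSup_eq_maximum) auto
  with t show ?thesis by auto
qed

definition diag_mean :: "nat \<Rightarrow> complex mat \<Rightarrow> (nat \<Rightarrow> complex vec) \<Rightarrow> complex" where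
  "diag_mean n A e = (1 / of_nat n) * (\<Sum>j<n. (A *\<^sub>v e j) \<bullet>c e j)"

definition diag_deviation :: "nat \<Rightarrow> real \<Rightarrow> complex mat \<Rightarrow> (nat \<Rightarrow> complex vec) \<Rightarrow> real" where
  "diag_deviation n p A e =
     ((1 / real n) * (\<Sum>i<n. cmod ((A *\<^sub>v e i) \<bullet>c e i - diag_mean n A e) powr p)) powr (1 / p)"

end

theory Submission
  imports "HOL-Analysis.Convex_Euclidean_Space" Defs
begin

text \<open>
  If the spectrum of a normal matrix lies in a disc with centre \<open>c\<close> and radius \<open>R\<close>, then so does
  its numerical range: for normal \<open>B\<close> the norms of \<open>B\<^sup>k x\<close> form a log-convex sequence, so
  \<open>B\<close> expanding some \<open>x\<close> would force exponential growth, whereas the powers of \<open>B\<close> are bounded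
  as soon as its spectral radius is below 1. By Jung's theorem in the plane one can take
  \<open>R = spd(A) / sqrt 3\<close>, and \<open>R = spd(A) / 2\<close> if the spectrum is real.

  It remains to see that points \<open>w\<close> of the unit disc with mean \<open>m\<close> have \<open>p\<close>-th central
  moment at most \<open>2\<^sup>p b\<^sub>p\<close>. With \<open>q = |m|\<close> one has
  \<open>|w - m|\<^sup>2 \<le> W := 1 + q\<^sup>2 - 2 Re (w cnj m)\<close>, and \<open>W\<close> has mean \<open>1 - q\<^sup>2\<close> and values between
  \<open>(1 - q)\<^sup>2\<close> and \<open>(1 + q)\<^sup>2\<close>. For \<open>p \<le> 2\<close> concavity of \<open>x\<^bsup>p/2\<^esup>\<close> bounds the moment by 1,
  and for \<open>p \<ge> 2\<close> its convexity bounds the moment by that of a two-point distribution.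
\<close>

section \<open>Jung's theorem in the plane\<close>

text \<open>The left side of the hypothesis exceeds \<open>V\<close> by \<epsilon> * ((K - 2 * V) -
  \<epsilon> * (K - V)). Dividing by \<epsilon> and letting \<epsilon> tend to 0 leaves K - 2 * V
  \<le> 0; this is the derivative test at a maximum.\<close>

lemma first_order_bound:
  fixes K V :: real
  assumes "0 \<le> V" and *: "\<And>\<epsilon>. 0 < \<epsilon> \<Longrightarrow> \<epsilon> \<le> 1 \<Longrightarrow> (1 - \<epsilon>)\<^sup>2 * V + \<epsilon> * (1 - \<epsilon>) * K \<le> V"
  shows "K \<le> 2 * V"
proof (rule ccontr)
  assume "\<not> K \<le> 2 * V"
  then have K: "K - 2 * V > 0" "K - V > 0" using assms(1) by auto
  \<comment> \<open>With this choice \<epsilon> * (K - V) is half of K - 2 * V, so the bracket stays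
    positive.\<close>
  define \<epsilon> where "\<epsilon> = (K - 2 * V) / (2 * (K - V))"
  have \<epsilon>: "0 < \<epsilon>" "\<epsilon> \<le> 1" "\<epsilon> * (2 * (K - V)) = K - 2 * V"
    using K assms(1) by (auto simp: \<epsilon>_def field_simps)
  have "\<epsilon> * ((K - 2 * V) - \<epsilon> * (K - V)) \<le> 0"
    using *[OF \<epsilon>(1,2)] by (simp add: algebra_simps power2_eq_square)
  then have "(K - 2 * V) - \<epsilon> * (K - V) \<le> 0"
    using \<epsilon>(1) by (simp add: mult_le_0_iff)
  with \<epsilon>(3) K show False by (simp add: algebra_simps)
qed

text \<open>If \<open>x\<close>, \<open>y\<close>, \<open>z\<close> are the squared side lengths of a triangle, then \<open>V\<close> is the variance of
  its vertices with weights \<open>r\<close>, \<open>s\<close>, \<open>t\<close>. At a maximum, moving weight towards a vertex does not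
  increase \<open>V\<close>, and this says that no vertex is further than \<open>sqrt V\<close> from the barycentre.\<close>

lemma simplex_variance_maximizer:
  fixes x y z :: real
  obtains r s t V where "0 \<le> r" "0 \<le> s" "0 \<le> t" "r + s + t = 1"
    and "V = r * s * x + r * t * y + s * t * z"
    and "s * x + t * y \<le> 2 * V" "r * x + t * z \<le> 2 * V" "r * y + s * z \<le> 2 * V"
proof -
  define F where "F r s t = r * s * x + r * t * y + s * t * z" for r s t
  \<comment> \<open>The simplex of weights is parametrised by \<open>(s, t)\<close>, with
    \<open>r\<close> recovered as 1 - s - t, so that compactness is that of a triangle in the
    plane.\<close>
  define T where "T = {u::real \<times> real. 0 \<le> fst u \<and> 0 \<le> snd u \<and> fst u + snd u \<le> 1}"
  have "closed T" unfolding T_def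
    by (intro closed_Collect_conj closed_Collect_le continuous_intros)
  moreover have "T \<subseteq> {0..1} \<times> {0..1}" by (auto simp: T_def)
  then have "bounded T"
    by (rule bounded_subset[rotated]) (intro bounded_Times compact_imp_bounded compact_Icc)
  ultimately have "compact T" by (simp add: compact_eq_bounded_closed)
  moreover have "T \<noteq> {}" by (auto simp: T_def intro!: exI[of _ 0])
  moreover have "continuous_on T (\<lambda>u. F (1 - fst u - snd u) (fst u) (snd u))"
    unfolding F_def by (intro continuous_intros)
  ultimately obtain u where u: "u \<in> T"
    "\<forall>v\<in>T. F (1 - fst v - snd v) (fst v) (snd v) \<le> F (1 - fst u - snd u) (fst u) (snd u)"
    using continuous_attains_sup by blast
  define s t r where "s = fst u" and "t = snd u" and "r = 1 - s - t"
  have rst: "0 \<le> r" "0 \<le> s" "0 \<le> t" "r + s + t = 1"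
    using u(1) by (auto simp: T_def r_def s_def t_def)
  have max: "F r' s' t' \<le> F r s t" if "0 \<le> r'" "0 \<le> s'" "0 \<le> t'" "r' + s' + t' = 1" for r' s' t'
  proof -
    have r': "r' = 1 - s' - t'" using that by simp
    show ?thesis using u(2)[rule_format, of "(s', t')"] that
      unfolding r' by (simp add: T_def r_def s_def t_def)
  qed
  have V: "0 \<le> F r s t" using max[of 1 0 0] by (simp add: F_def)
  show ?thesis
  proof (rule that[OF rst])
    show "F r s t = r * s * x + r * t * y + s * t * z" by (simp add: F_def)
    show "s * x + t * y \<le> 2 * F r s t"
    proof (rule first_order_bound[OF V])
      fix \<epsilon> :: real assume e: "0 < \<epsilon>" "\<epsilon> \<le> 1"
      \<comment> \<open>The fraction \<epsilon> of the total weight moves to the first vertex. Since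
        \<open>F\<close> has no square terms, its new value has exactly the form that
        \<open>first_order_bound\<close> expects. The other two vertices are treated alike.\<close>
      have "F ((1 - \<epsilon>) * r + \<epsilon>) ((1 - \<epsilon>) * s) ((1 - \<epsilon>) * t) \<le> F r s t"
      proof (rule max)
        have "(1 - \<epsilon>) * r + \<epsilon> + (1 - \<epsilon>) * s + (1 - \<epsilon>) * t = (1 - \<epsilon>) * (r + s + t) + \<epsilon>"
          by (simp add: algebra_simps)
        then show "(1 - \<epsilon>) * r + \<epsilon> + (1 - \<epsilon>) * s + (1 - \<epsilon>) * t = 1" using rst by simp
      qed (use e rst in auto)
      then show "(1 - \<epsilon>)\<^sup>2 * F r s t + \<epsilon> * (1 - \<epsilon>) * (s * x + t * y) \<le> F r s t"
        by (simp add: F_def power2_eq_square algebra_simps)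
    qed
    show "r * x + t * z \<le> 2 * F r s t"
    proof (rule first_order_bound[OF V])
      fix \<epsilon> :: real assume e: "0 < \<epsilon>" "\<epsilon> \<le> 1"
      have "F ((1 - \<epsilon>) * r) ((1 - \<epsilon>) * s + \<epsilon>) ((1 - \<epsilon>) * t) \<le> F r s t"
      proof (rule max)
        have "(1 - \<epsilon>) * r + ((1 - \<epsilon>) * s + \<epsilon>) + (1 - \<epsilon>) * t = (1 - \<epsilon>) * (r + s + t) + \<epsilon>"
          by (simp add: algebra_simps)
        then show "(1 - \<epsilon>) * r + ((1 - \<epsilon>) * s + \<epsilon>) + (1 - \<epsilon>) * t = 1" using rst by simp
      qed (use e rst in auto)
      then show "(1 - \<epsilon>)\<^sup>2 * F r s t + \<epsilon> * (1 - \<epsilon>) * (r * x + t * z) \<le> F r s t"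
        by (simp add: F_def power2_eq_square algebra_simps)
    qed
    show "r * y + s * z \<le> 2 * F r s t"
    proof (rule first_order_bound[OF V])
      fix \<epsilon> :: real assume e: "0 < \<epsilon>" "\<epsilon> \<le> 1"
      have "F ((1 - \<epsilon>) * r) ((1 - \<epsilon>) * s) ((1 - \<epsilon>) * t + \<epsilon>) \<le> F r s t"
      proof (rule max)
        have "(1 - \<epsilon>) * r + (1 - \<epsilon>) * s + ((1 - \<epsilon>) * t + \<epsilon>) = (1 - \<epsilon>) * (r + s + t) + \<epsilon>"
          by (simp add: algebra_simps)
        then show "(1 - \<epsilon>) * r + (1 - \<epsilon>) * s + ((1 - \<epsilon>) * t + \<epsilon>) = 1" using rst by simp
      qed (use e rst in auto)
      then show "(1 - \<epsilon>)\<^sup>2 * F r s t + \<epsilon> * (1 - \<epsilon>) * (r * y + s * z) \<le> F r s t"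
        by (simp add: F_def power2_eq_square algebra_simps)
    qed
  qed
qed

text \<open>Parallel axis theorem: the weighted mean of the squared distances from \<open>w\<close>
  is the squared distance to the barycentre plus the variance of the vertices, the latter written
  through pairwise distances.\<close>

lemma dist_barycenter:
  fixes a b c w :: "'a::real_inner"
  assumes "r + s + t = 1"
  shows "(dist w (r *\<^sub>R a + s *\<^sub>R b + t *\<^sub>R c))\<^sup>2 =
    r * (dist w a)\<^sup>2 + s * (dist w b)\<^sup>2 + t * (dist w c)\<^sup>2
    - (r * s * (dist a b)\<^sup>2 + r * t * (dist a c)\<^sup>2 + s * t * (dist b c)\<^sup>2)"
proof -
  have r: "r = 1 - s - t" using assms by simp
  show ?thesis
    unfolding dist_norm power2_norm_eq_inner r
    by (simp add: inner_diff_left inner_diff_right inner_add_left inner_add_right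
        algebra_simps inner_commute)
qed

text \<open>The common point is the barycentre for the weights of maximal variance \<open>V\<close>:
  it is within \<open>sqrt V\<close> of each vertex, and \<open>V\<close> is at most (r * s + r * t
  + s * t) times the square of \<open>d\<close>, where the factor is at most 1/3.\<close>

lemma jung_three_points:
  fixes a b c :: "'a::real_inner"
  assumes d: "dist a b \<le> d" "dist a c \<le> d" "dist b c \<le> d"
  shows "cball a (d / sqrt 3) \<inter> cball b (d / sqrt 3) \<inter> cball c (d / sqrt 3) \<noteq> {}"
proof -
  obtain r s t V where rst: "0 \<le> r" "0 \<le> s" "0 \<le> t" "r + s + t = 1"
    and V: "V = r * s * (dist a b)\<^sup>2 + r * t * (dist a c)\<^sup>2 + s * t * (dist b c)\<^sup>2"
    and opt: "s * (dist a b)\<^sup>2 + t * (dist a c)\<^sup>2 \<le> 2 * V"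
      "r * (dist a b)\<^sup>2 + t * (dist b c)\<^sup>2 \<le> 2 * V"
      "r * (dist a c)\<^sup>2 + s * (dist b c)\<^sup>2 \<le> 2 * V"
    by (rule simplex_variance_maximizer)
  define w where "w = r *\<^sub>R a + s *\<^sub>R b + t *\<^sub>R c"
  have d0: "0 \<le> d" using d(1) zero_le_dist order_trans by blast
  have sq: "(dist a b)\<^sup>2 \<le> d\<^sup>2" "(dist a c)\<^sup>2 \<le> d\<^sup>2" "(dist b c)\<^sup>2 \<le> d\<^sup>2"
    using d by (auto intro: power_mono)
  have "V \<le> r * s * d\<^sup>2 + r * t * d\<^sup>2 + s * t * d\<^sup>2"
    unfolding V using rst sq by (intro add_mono mult_left_mono) auto
  also have "\<dots> = (r * s + r * t + s * t) * d\<^sup>2" by (simp add: algebra_simps)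
  also have "\<dots> \<le> 1 / 3 * d\<^sup>2"
  proof (rule mult_right_mono)
    have "1 - 3 * (r * s + r * t + s * t) = (r + s + t)\<^sup>2 - 3 * (r * s + r * t + s * t)"
      using rst by simp
    also have "\<dots> = ((r - s)\<^sup>2 + (r - t)\<^sup>2 + (s - t)\<^sup>2) / 2"
      by (simp add: power2_eq_square algebra_simps)
    also have "\<dots> \<ge> 0" by simp
    finally show "r * s + r * t + s * t \<le> 1 / 3" by simp
  qed simp
  finally have V3: "V \<le> (d / sqrt 3)\<^sup>2" by (simp add: power_divide)
  \<comment> \<open>Taking a vertex for the free point in \<open>dist_barycenter\<close> gives, for
    \<open>a\<close>, the value s * |ab|^2 + t * |ac|^2 - V, which is at most 2 * V - V.\<close>
  have "(dist a w)\<^sup>2 \<le> V" "(dist b w)\<^sup>2 \<le> V" "(dist c w)\<^sup>2 \<le> V"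
    using opt unfolding w_def dist_barycenter[OF rst(4)] V[symmetric]
    by (auto simp: dist_commute)
  with V3 have "(dist a w)\<^sup>2 \<le> (d / sqrt 3)\<^sup>2" "(dist b w)\<^sup>2 \<le> (d / sqrt 3)\<^sup>2" "(dist c w)\<^sup>2 \<le> (d / sqrt 3)\<^sup>2"
    by linarith+
  then have "dist a w \<le> d / sqrt 3" "dist b w \<le> d / sqrt 3" "dist c w \<le> d / sqrt 3"
    using d0 by (auto intro: power2_le_imp_le)
  then have "w \<in> cball a (d / sqrt 3) \<inter> cball b (d / sqrt 3) \<inter> cball c (d / sqrt 3)" by simp
  then show ?thesis by blast
qed

text \<open>The three elements may coincide, so families of one, two or three discs are all covered
  by the three-point case.\<close>

lemma card_le_3E:
  assumes "finite X" "card X \<le> 3" "X \<noteq> {}"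
  obtains a b c where "X = {a, b, c}"
proof -
  consider "card X = 1" | "card X = 2" | "card X = 3"
    using assms by (metis One_nat_def Suc_1 card_0_eq le_SucE le_zero_eq numeral_3_eq_3)
  then show ?thesis
  proof cases
    case 1 then show ?thesis using that by (metis card_1_singletonE insert_absorb2)
  next
    case 2 then show ?thesis using that by (metis card_2_iff insert_absorb2)
  next
    case 3 then show ?thesis using that by (metis card_3_iff)
  qed
qed

text \<open>A centre is a common point of the discs of radius d / sqrt 3 around the points of
  \<open>S\<close>. Any three of them meet by \<open>jung_three_points\<close>, hence all do by
  Helly's theorem in real dimension 2.\<close>

theorem jung_complex:
  fixes S :: "complex set"
  assumes "finite S" and d: "\<And>x y. x \<in> S \<Longrightarrow> y \<in> S \<Longrightarrow> dist x y \<le> d"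
  obtains c where "\<And>x. x \<in> S \<Longrightarrow> dist x c \<le> d / sqrt 3"
proof -
  define \<F> where "\<F> = (\<lambda>x. cball x (d / sqrt 3)) ` S"
  have three: "\<Inter>\<T> \<noteq> {}" if T: "\<T> \<subseteq> \<F>" "card \<T> \<le> 3" for \<T>
  proof (cases "\<T> = {}")
    case False
    have "finite \<T>" using T assms(1) by (auto simp: \<F>_def intro: finite_subset)
    then obtain X Y Z where XYZ: "\<T> = {X, Y, Z}" using card_le_3E T False by metis
    with T obtain a b c where "a \<in> S" "b \<in> S" "c \<in> S" "X = cball a (d / sqrt 3)"
      "Y = cball b (d / sqrt 3)" "Z = cball c (d / sqrt 3)" by (auto simp: \<F>_def)
    with jung_three_points[of a b d c] d show ?thesis by (simp add: XYZ Int_assoc)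
  qed auto
  \<comment> \<open>Helly's theorem is applied to families of more than three discs; the smaller
    ones are instances of \<open>three\<close>.\<close>
  have "\<Inter>\<F> \<noteq> {}"
  proof (cases "card \<F> \<le> 3")
    case False
    show ?thesis
    proof (rule Helly)
      show "DIM(complex) + 1 \<le> card \<F>" using False by simp
      show "\<forall>s\<in>\<F>. convex s" by (auto simp: \<F>_def)
      show "\<Inter>\<T> \<noteq> {}" if "\<T> \<subseteq> \<F>" "card \<T> = DIM(complex) + 1" for \<T>
        using three that by simp
    qed
  qed (use three in blast)
  then obtain c where "c \<in> \<Inter>\<F>" by blast
  then show ?thesis by (intro that[of c]) (simp add: \<F>_def)
qed

section \<open>Central moments of points in a disc\<close>

text \<open>Weighted AM-GM for 1 and \<open>x\<close>, from the convexity of exp between 0 and ln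
  x.\<close>

lemma powr_le_tangent_1:
  fixes x s :: real
  assumes "0 \<le> x" "0 < s" "s \<le> 1"
  shows "x powr s \<le> 1 + s * (x - 1)"
proof (cases "x = 0")
  case False
  then have "x > 0" using assms by simp
  have "exp ((1 - s) *\<^sub>R 0 + s *\<^sub>R ln x) \<le> (1 - s) * exp 0 + s * exp (ln x)"
    by (rule convex_onD[OF exp_convex]) (use assms in auto)
  then show ?thesis using \<open>x > 0\<close> by (simp add: powr_def algebra_simps)
qed (use assms in auto)

text \<open>The endpoint \<open>u = 0\<close> is included because the interval used below starts at
  0 when the mean has modulus 1. There the claim reduces to \<sigma> powr s \<le> \<sigma>.\<close>

lemma powr_le_chord:
  fixes u v s \<sigma> :: real
  assumes s: "1 \<le> s" and uv: "0 \<le> u" "0 < v" and \<sigma>: "0 \<le> \<sigma>" "\<sigma> \<le> 1"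
  shows "((1 - \<sigma>) * u + \<sigma> * v) powr s \<le> (1 - \<sigma>) * u powr s + \<sigma> * v powr s"
proof (cases "u = 0")
  case True
  have "\<sigma> powr s \<le> \<sigma>" using powr_mono'[of 1 s \<sigma>] s \<sigma> by simp
  then have "\<sigma> powr s * v powr s \<le> \<sigma> * v powr s" by (intro mult_right_mono) auto
  then show ?thesis using True \<sigma> uv by (simp add: powr_mult)
next
  case False
  then show ?thesis
    using convex_onD[OF powr_convex[OF s] \<sigma>, of u v] uv by simp
qed

lemma bernoulli_moment_le:
  assumes "0 < p" "0 \<le> t" "t \<le> 1"
  shows "t powr p * (1 - t) + t * (1 - t) powr p \<le> bernoulli_moment_max p"
  using bernoulli_moment_max_attained[OF assms(1)] assms(2,3) by auto

text \<open>Evaluation at t = 1/2, the symmetric two-point distribution. It makes a bound by 1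
  sufficient for moments in the unit disc.\<close>

lemma bernoulli_moment_max_half:
  assumes "0 < p"
  shows "1 \<le> 2 powr p * bernoulli_moment_max p"
proof -
  have "(1 / 2) powr p \<le> bernoulli_moment_max p"
    using bernoulli_moment_le[OF assms, of "1 / 2"] by simp
  then have "2 powr p * (1 / 2) powr p \<le> 2 powr p * bernoulli_moment_max p"
    by (intro mult_left_mono) auto
  then show ?thesis by (simp flip: powr_mult)
qed

lemma unit_disc_central_moment:
  fixes w :: "'a \<Rightarrow> complex" and p :: real
  assumes fin: "finite I" and ne: "I \<noteq> {}" and w: "\<And>i. i \<in> I \<Longrightarrow> cmod (w i) \<le> 1" and p: "1 \<le> p"
    and m: "m = (\<Sum>i\<in>I. w i) / of_nat (card I)"
  shows "(\<Sum>i\<in>I. cmod (w i - m) powr p) \<le> real (card I) * (2 powr p * bernoulli_moment_max p)"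
proof -
  define q where "q = cmod m"
  \<comment> \<open>This is |w i - m|^2 with |w i|^2 replaced by its upper bound 1. Being affine in
    \<open>w i\<close>, it has a mean determined by \<open>m\<close> alone.\<close>
  define W where "W i = 1 + q\<^sup>2 - 2 * Re (w i * cnj m)" for i
  have N: "real (card I) > 0" using fin ne by (simp add: card_gt_0_iff)
  have summ: "(\<Sum>i\<in>I. w i) = of_nat (card I) * m" using N by (simp add: m)
  have "cmod (\<Sum>i\<in>I. w i) \<le> real (card I)"
    using sum_norm_le[of I w "\<lambda>_. 1"] w by simp
  then have q: "0 \<le> q" "q \<le> 1" using N by (auto simp: q_def m norm_divide)
  have Re_le: "\<bar>Re (w i * cnj m)\<bar> \<le> q" if "i \<in> I" for i
  proof -
    have "\<bar>Re (w i * cnj m)\<bar> \<le> cmod (w i * cnj m)" by (rule abs_Re_le_cmod)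
    also have "\<dots> \<le> 1 * q" unfolding norm_mult using w[OF that] by (intro mult_mono) (auto simp: q_def)
    finally show ?thesis by simp
  qed
  have W: "(1 - q)\<^sup>2 \<le> W i" "W i \<le> (1 + q)\<^sup>2" if "i \<in> I" for i
    using Re_le[OF that] by (auto simp: W_def power2_eq_square algebra_simps abs_le_iff)
  have W0: "0 \<le> W i" if "i \<in> I" for i using W[OF that] by (meson order_trans zero_le_power2)
  have le_W: "(cmod (w i - m))\<^sup>2 \<le> W i" if "i \<in> I" for i
  proof -
    have "(cmod (w i - m))\<^sup>2 = (cmod (w i))\<^sup>2 + q\<^sup>2 - 2 * Re (w i * cnj m)"
      unfolding q_def cmod_power2 by (simp add: power2_eq_square algebra_simps)
    moreover have "(cmod (w i))\<^sup>2 \<le> 1" using w[OF that] by (simp add: power_le_one)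
    ultimately show ?thesis by (simp add: W_def)
  qed
  have term_le: "cmod (w i - m) powr p \<le> W i powr (p / 2)" if "i \<in> I" for i
  proof -
    have "cmod (w i - m) powr p = ((cmod (w i - m))\<^sup>2) powr (p / 2)"
      by (simp add: powr_powr flip: powr_numeral)
    also have "\<dots> \<le> W i powr (p / 2)" using le_W[OF that] p by (intro powr_mono2) auto
    finally show ?thesis .
  qed
  have sumW: "(\<Sum>i\<in>I. W i) = real (card I) * (1 - q\<^sup>2)"
  proof -
    have "(\<Sum>i\<in>I. Re (w i * cnj m)) = Re ((\<Sum>i\<in>I. w i) * cnj m)" by (simp add: sum_distrib_right)
    also have "\<dots> = real (card I) * q\<^sup>2"
      unfolding summ q_def cmod_power2 by (simp add: power2_eq_square algebra_simps)
    finally have "(\<Sum>i\<in>I. Re (w i * cnj m)) = real (card I) * q\<^sup>2" .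
    then show ?thesis unfolding W_def sum_subtractf sum.distrib sum_distrib_left[symmetric]
      by (simp add: algebra_simps)
  qed
  have "(\<Sum>i\<in>I. W i powr (p / 2)) \<le> real (card I) * (2 powr p * bernoulli_moment_max p)"
  proof (cases "p \<le> 2")
    case True
    \<comment> \<open>The tangent at 1 suffices because the mean 1 - q^2 of \<open>W\<close> does
      not exceed 1.\<close>
    have "(\<Sum>i\<in>I. W i powr (p / 2)) \<le> (\<Sum>i\<in>I. 1 + p / 2 * (W i - 1))"
      using W0 p True by (intro sum_mono powr_le_tangent_1) auto
    also have "\<dots> = real (card I) * (1 - p / 2 * q\<^sup>2)"
      by (simp add: sum.distrib sum_subtractf sumW algebra_simps flip: sum_distrib_left sum_divide_distrib)
    also have "\<dots> \<le> real (card I) * 1" using p by (intro mult_left_mono) auto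
    also have "\<dots> \<le> real (card I) * (2 powr p * bernoulli_moment_max p)"
      using bernoulli_moment_max_half[of p] p by (intro mult_left_mono) auto
    finally show ?thesis .
  next
    case False
    show ?thesis
    proof (cases "q = 0")
      case True
      have "(\<Sum>i\<in>I. W i powr (p / 2)) = real (card I) * 1"
        using True by (simp add: W_def q_def)
      also have "\<dots> \<le> real (card I) * (2 powr p * bernoulli_moment_max p)"
        using bernoulli_moment_max_half[of p] p by (intro mult_left_mono) auto
      finally show ?thesis .
    next
      case False
      then have q0: "q > 0" using q by simp
      \<comment> \<open>Position of \<open>W i\<close> on the interval from (1 - q)^2 to (1 + q)^2,
        which has length 4 * q; hence the separate case q = 0.\<close>
      define \<sigma> where "\<sigma> i = (W i - (1 - q)\<^sup>2) / (4 * q)" for i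
      have "W i powr (p / 2) \<le> (1 - \<sigma> i) * (1 - q) powr p + \<sigma> i * (1 + q) powr p" if "i \<in> I" for i
      proof -
        have s: "0 \<le> \<sigma> i" "\<sigma> i \<le> 1"
          using W[OF that] q0 by (auto simp: \<sigma>_def field_simps power2_eq_square)
        have Weq: "W i = (1 - \<sigma> i) * (1 - q)\<^sup>2 + \<sigma> i * (1 + q)\<^sup>2"
          using q0 by (simp add: \<sigma>_def field_simps power2_eq_square)
        have pw: "((1 - q)\<^sup>2) powr (p / 2) = (1 - q) powr p" "((1 + q)\<^sup>2) powr (p / 2) = (1 + q) powr p"
          using q by (simp_all add: powr_powr flip: powr_numeral)
        show ?thesis unfolding Weq pw[symmetric]
          by (rule powr_le_chord) (use s q \<open>\<not> p \<le> 2\<close> in auto)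
      qed
      then have "(\<Sum>i\<in>I. W i powr (p / 2))
          \<le> (\<Sum>i\<in>I. (1 - \<sigma> i) * (1 - q) powr p + \<sigma> i * (1 + q) powr p)" by (rule sum_mono)
      also have "\<dots> = (real (card I) - (\<Sum>i\<in>I. \<sigma> i)) * (1 - q) powr p + (\<Sum>i\<in>I. \<sigma> i) * (1 + q) powr p"
        by (simp add: sum.distrib sum_subtractf flip: sum_distrib_right)
      \<comment> \<open>The mean of \<sigma> is ((1 - q^2) - (1 - q)^2) / (4 * q).\<close>
      also have "(\<Sum>i\<in>I. \<sigma> i) = real (card I) * ((1 - q) / 2)"
        using q0 by (simp add: \<sigma>_def sum_subtractf sumW field_simps power2_eq_square flip: sum_divide_distrib)
      \<comment> \<open>With t = (1 - q) / 2 the two-point moment is 2 powr p times the Bernoulli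
        moment at \<open>t\<close>.\<close>
      also have "(real (card I) - real (card I) * ((1 - q) / 2)) * (1 - q) powr p
          + real (card I) * ((1 - q) / 2) * (1 + q) powr p
        = real (card I) * (2 powr p * (((1 - q) / 2) powr p * (1 - (1 - q) / 2)
          + (1 - q) / 2 * (1 - (1 - q) / 2) powr p))"
      proof -
        define a b where "a = ((1 - q) / 2) powr p" and "b = (1 - (1 - q) / 2) powr p"
        have h: "2 * ((1 - q) / 2) = 1 - q" "2 * (1 - (1 - q) / 2) = 1 + q"
          by (simp_all add: field_simps)
        have "(1 - q) powr p = 2 powr p * a" "(1 + q) powr p = 2 powr p * b"
          using q powr_mult[of 2 "(1 - q) / 2" p] powr_mult[of 2 "1 - (1 - q) / 2" p]
          by (simp_all only: h a_def b_def)
        then show ?thesis unfolding a_def[symmetric] b_def[symmetric] by (simp add: field_simps)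
      qed
      also have "\<dots> \<le> real (card I) * (2 powr p * bernoulli_moment_max p)"
        using q p by (intro mult_left_mono bernoulli_moment_le) auto
      finally show ?thesis .
    qed
  qed
  moreover have "(\<Sum>i\<in>I. cmod (w i - m) powr p) \<le> (\<Sum>i\<in>I. W i powr (p / 2))"
    by (intro sum_mono term_le)
  ultimately show ?thesis by linarith
qed

text \<open>The substitution w = (z - c) / R reduces to the unit disc and scales the moment by R
  powr p. For R = 0 all points coincide and both sides vanish.\<close>

lemma disc_central_moment:
  fixes z :: "'a \<Rightarrow> complex" and p R :: real
  assumes fin: "finite I" and ne: "I \<noteq> {}" and z: "\<And>i. i \<in> I \<Longrightarrow> dist (z i) c \<le> R" and p: "1 \<le> p"
    and m: "m = (\<Sum>i\<in>I. z i) / of_nat (card I)"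
  shows "((\<Sum>i\<in>I. cmod (z i - m) powr p) / card I) powr (1 / p)
    \<le> 2 * R * bernoulli_moment_max p powr (1 / p)"
proof -
  have N: "real (card I) > 0" using fin ne by (simp add: card_gt_0_iff)
  obtain i where "i \<in> I" using ne by blast
  then have R0: "0 \<le> R" using z order_trans zero_le_dist by blast
  have b0: "0 \<le> bernoulli_moment_max p"
    using bernoulli_moment_le[of p 0] p by simp
  show ?thesis
  proof (cases "R = 0")
    case True
    then have zc: "z i = c" if "i \<in> I" for i using z[OF that] by simp
    then have "m = c" using N by (simp add: m)
    then show ?thesis using zc True by simp
  next
    case False
    then have R: "R > 0" using R0 by simp
    define w where "w i = (z i - c) / of_real R" for i
    define m' where "m' = (\<Sum>i\<in>I. w i) / of_nat (card I)"
    have m': "m' = (m - c) / of_real R"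
      using N R by (simp add: m'_def w_def m sum_subtractf field_simps flip: sum_divide_distrib)
    have "cmod (z i - m) powr p = R powr p * cmod (w i - m') powr p" for i
    proof -
      have "w i - m' = (z i - m) / of_real R" by (simp add: w_def m' flip: diff_divide_distrib)
      then have "cmod (z i - m) = R * cmod (w i - m')" using R by (simp add: norm_divide)
      then show ?thesis using R by (simp add: powr_mult)
    qed
    then have "(\<Sum>i\<in>I. cmod (z i - m) powr p) = R powr p * (\<Sum>i\<in>I. cmod (w i - m') powr p)"
      by (simp add: sum_distrib_left)
    also have "\<dots> \<le> R powr p * (real (card I) * (2 powr p * bernoulli_moment_max p))"
      using z R by (intro mult_left_mono unit_disc_central_moment[OF fin ne _ p m'_def])
        (auto simp: w_def norm_divide dist_norm)
    finally have "(\<Sum>i\<in>I. cmod (z i - m) powr p) / card I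
        \<le> (2 * R) powr p * bernoulli_moment_max p"
      using N R by (simp add: divide_le_eq powr_mult mult_ac)
    then have "((\<Sum>i\<in>I. cmod (z i - m) powr p) / card I) powr (1 / p)
        \<le> ((2 * R) powr p * bernoulli_moment_max p) powr (1 / p)"
      using p by (intro powr_mono2) (auto intro!: sum_nonneg divide_nonneg_nonneg)
    also have "\<dots> = 2 * R * bernoulli_moment_max p powr (1 / p)"
      using R b0 p by (simp add: powr_mult powr_powr)
    finally show ?thesis .
  qed
qed

section \<open>The numerical range of a normal matrix\<close>

text \<open>Expressed through \<open>L2_set\<close> so that Cauchy-Schwarz comes from
  \<open>L2_set_mult_ineq\<close>.\<close>

definition vec_norm2 :: "complex vec \<Rightarrow> real" where
  "vec_norm2 v = L2_set (\<lambda>i. cmod (v $ i)) {0..<dim_vec v}"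

lemma vec_norm2_nonneg [simp]: "0 \<le> vec_norm2 v"
  by (simp add: vec_norm2_def)

lemma cscalar_prod_self:
  fixes v :: "complex vec"
  shows "v \<bullet>c v = of_real ((vec_norm2 v)\<^sup>2)"
proof -
  have "(vec_norm2 v)\<^sup>2 = (\<Sum>i = 0..<dim_vec v. (cmod (v $ i))\<^sup>2)"
    by (simp add: vec_norm2_def L2_set_def sum_nonneg)
  then show ?thesis
    unfolding scalar_prod_def of_real_sum by (simp only: of_real_sum complex_norm_square) simp
qed

lemma cscalar_prod_Cauchy_Schwarz:
  fixes v w :: "complex vec"
  assumes "dim_vec v = dim_vec w"
  shows "cmod (v \<bullet>c w) \<le> vec_norm2 v * vec_norm2 w"
proof -
  have "cmod (v \<bullet>c w) \<le> (\<Sum>i\<in>{0..<dim_vec w}. \<bar>cmod (v $ i)\<bar> * \<bar>cmod (w $ i)\<bar>)"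
    unfolding scalar_prod_def by (rule order_trans[OF norm_sum]) (simp add: norm_mult)
  also have "\<dots> \<le> vec_norm2 v * vec_norm2 w"
    unfolding vec_norm2_def assms by (rule L2_set_mult_ineq)
  finally show ?thesis .
qed

lemma vec_norm2_smult: "vec_norm2 (k \<cdot>\<^sub>v v) = cmod k * vec_norm2 v"
proof -
  have "L2_set (\<lambda>i. cmod ((k \<cdot>\<^sub>v v) $ i)) {0..<dim_vec v}
      = L2_set (\<lambda>i. cmod k * cmod (v $ i)) {0..<dim_vec v}"
    by (rule L2_set_cong) (auto simp: norm_mult)
  then show ?thesis by (simp add: vec_norm2_def L2_set_right_distrib)
qed

section \<open>The adjoint, and norms along the powers of a normal matrix\<close>

lemma mat_adjoint_dim [simp]:
  "dim_row (mat_adjoint A) = dim_col A" "dim_col (mat_adjoint A) = dim_row A"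
  by (simp_all add: mat_adjoint_def)

lemma mat_adjoint_carrier [simp]:
  "A \<in> carrier_mat n m \<Longrightarrow> mat_adjoint A \<in> carrier_mat m n"
  by (rule carrier_matI) simp_all

lemma mat_adjoint_index [simp]:
  fixes A :: "complex mat"
  assumes "i < dim_col A" "j < dim_row A"
  shows "mat_adjoint A $$ (i, j) = cnj (A $$ (j, i))"
  using assms by (simp add: mat_adjoint_def mat_of_rows_def)

lemma cscalar_prod_adjoint:
  fixes A :: "complex mat"
  assumes A: "A \<in> carrier_mat n m" and x: "x \<in> carrier_vec m" and y: "y \<in> carrier_vec n"
  shows "(A *\<^sub>v x) \<bullet>c y = x \<bullet>c (mat_adjoint A *\<^sub>v y)"
proof -
  have "(A *\<^sub>v x) \<bullet>c y = (\<Sum>i = 0..<n. \<Sum>j = 0..<m. A $$ (i, j) * x $ j * cnj (y $ i))"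
    using assms by (simp add: scalar_prod_def sum_distrib_right)
  also have "\<dots> = (\<Sum>j = 0..<m. \<Sum>i = 0..<n. A $$ (i, j) * x $ j * cnj (y $ i))"
    by (rule sum.swap)
  also have "\<dots> = x \<bullet>c (mat_adjoint A *\<^sub>v y)"
    using assms by (simp add: scalar_prod_def sum_distrib_left mult_ac)
  finally show ?thesis .
qed

lemma mat_adjoint_adjoint [simp]:
  fixes A :: "complex mat"
  shows "mat_adjoint (mat_adjoint A) = A"
  by (rule eq_matI) auto

text \<open>The two squared norms are the quadratic forms of \<open>A * mat_adjoint A\<close> and
  \<open>mat_adjoint A * A\<close>, which agree by normality.\<close>

lemma normal_mat_norm_adjoint:
  assumes A: "A \<in> carrier_mat n n" and "normal_mat A" and x: "x \<in> carrier_vec n"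
  shows "vec_norm2 (mat_adjoint A *\<^sub>v x) = vec_norm2 (A *\<^sub>v x)"
proof -
  let ?A = "mat_adjoint A"
  have A': "?A \<in> carrier_mat n n" using A by simp
  have "(?A *\<^sub>v x) \<bullet>c (?A *\<^sub>v x) = x \<bullet>c (A *\<^sub>v (?A *\<^sub>v x))"
    using cscalar_prod_adjoint[OF A' x, of "?A *\<^sub>v x"] A' x by simp
  also have "A *\<^sub>v (?A *\<^sub>v x) = ?A *\<^sub>v (A *\<^sub>v x)"
    using assms(2) unfolding normal_mat_def
    by (metis A A' x assoc_mult_mat_vec)
  also have "x \<bullet>c (?A *\<^sub>v (A *\<^sub>v x)) = (A *\<^sub>v x) \<bullet>c (A *\<^sub>v x)"
    using cscalar_prod_adjoint[OF A x, of "A *\<^sub>v x"] A x by simp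
  finally have "(vec_norm2 (?A *\<^sub>v x))\<^sup>2 = (vec_norm2 (A *\<^sub>v x))\<^sup>2"
    unfolding cscalar_prod_self of_real_eq_iff .
  then show ?thesis by simp
qed

text \<open>Moving one factor \<open>A\<close> across the inner product and applying Cauchy-Schwarz
  leaves the norm of the adjoint at \<open>A *\<^sub>v x\<close>; normality turns the adjoint back
  into \<open>A\<close>.\<close>

lemma normal_mat_log_convex:
  assumes A: "A \<in> carrier_mat n n" and N: "normal_mat A" and x: "x \<in> carrier_vec n"
  shows "(vec_norm2 (A *\<^sub>v x))\<^sup>2 \<le> vec_norm2 x * vec_norm2 (A *\<^sub>v (A *\<^sub>v x))"
proof -
  have "(vec_norm2 (A *\<^sub>v x))\<^sup>2 = cmod ((A *\<^sub>v x) \<bullet>c (A *\<^sub>v x))"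
    unfolding cscalar_prod_self by (simp add: norm_power)
  also have "\<dots> = cmod (x \<bullet>c (mat_adjoint A *\<^sub>v (A *\<^sub>v x)))"
    using cscalar_prod_adjoint[OF A x, of "A *\<^sub>v x"] A x by simp
  also have "\<dots> \<le> vec_norm2 x * vec_norm2 (mat_adjoint A *\<^sub>v (A *\<^sub>v x))"
    using A x by (intro cscalar_prod_Cauchy_Schwarz) simp
  finally show ?thesis using normal_mat_norm_adjoint[OF A N, of "A *\<^sub>v x"] A x by simp
qed

text \<open>Log-convexity makes the ratios of consecutive terms nondecreasing, so each is at least
  the first one. Positivity is carried through the induction in order to cancel
  \<open>s k\<close>.\<close>

lemma log_convex_growth:
  fixes s :: "nat \<Rightarrow> real"
  assumes nn: "\<And>k. 0 \<le> s k" and lc: "\<And>k. (s (Suc k))\<^sup>2 \<le> s k * s (Suc (Suc k))"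
    and "s 0 < s 1" "0 < s 0"
  shows "(s 1 / s 0) ^ k * s 0 \<le> s k"
proof -
  define \<rho> where "\<rho> = s 1 / s 0"
  have \<rho>: "\<rho> > 0" using assms by (auto simp: \<rho>_def)
  have step: "0 < s k \<and> \<rho> * s k \<le> s (Suc k)" for k
  proof (induction k)
    case 0 then show ?case using assms by (simp add: \<rho>_def)
  next
    case (Suc k)
    then have pos: "0 < s (Suc k)" using \<rho> by (meson less_le_trans mult_pos_pos)
    have "s k * (\<rho> * s (Suc k)) \<le> s (Suc k) * s (Suc k)"
      using Suc pos by (simp add: mult.assoc mult.left_commute)
    also have "\<dots> \<le> s k * s (Suc (Suc k))" using lc[of k] by (simp add: power2_eq_square)
    finally show ?case using Suc pos by simp
  qed
  have "\<rho> ^ k * s 0 \<le> s k" for k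
  proof (induction k)
    case (Suc k)
    have "\<rho> ^ Suc k * s 0 \<le> \<rho> * s k" using Suc \<rho> by (simp add: mult.assoc)
    then show ?case using step[of k] by simp
  qed simp
  then show ?thesis by (simp add: \<rho>_def)
qed

text \<open>A crude estimate from the bound \<open>b\<close> on the entries. What matters is that it
  depends on \<open>M\<close> only through \<open>b\<close>, hence is uniform over all powers of a
  matrix.\<close>

lemma norm_bound_mult_vec:
  assumes M: "M \<in> carrier_mat n n" and b: "norm_bound M b" and x: "x \<in> carrier_vec n"
  shows "vec_norm2 (M *\<^sub>v x) \<le> real n * (b * (\<Sum>j = 0..<n. cmod (x $ j)))"
proof -
  have "vec_norm2 (M *\<^sub>v x) \<le> (\<Sum>i = 0..<n. \<bar>cmod ((M *\<^sub>v x) $ i)\<bar>)"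
    using M L2_set_le_sum_abs[of "\<lambda>i. cmod ((M *\<^sub>v x) $ i)" "{0..<n}"]
    by (simp only: vec_norm2_def dim_mult_mat_vec carrier_matD)
  also have "\<dots> \<le> (\<Sum>i = 0..<n. b * (\<Sum>j = 0..<n. cmod (x $ j)))"
  proof (rule sum_mono)
    fix i assume i: "i \<in> {0..<n}"
    have "cmod ((M *\<^sub>v x) $ i) \<le> (\<Sum>j = 0..<n. cmod (M $$ (i, j) * x $ j))"
      using i M x by (simp add: scalar_prod_def norm_sum)
    also have "\<dots> \<le> (\<Sum>j = 0..<n. b * cmod (x $ j))"
      using b i M by (intro sum_mono) (auto simp: norm_mult norm_bound_def intro!: mult_right_mono)
    finally show "\<bar>cmod ((M *\<^sub>v x) $ i)\<bar> \<le> b * (\<Sum>j = 0..<n. cmod (x $ j))"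
      by (simp add: sum_distrib_left)
  qed
  finally show ?thesis by simp
qed

text \<open>Matrix powers unfold with the new factor on the right; the iteration of \<open>A\<close>
  on a vector has it on the left.\<close>

lemma pow_mat_Suc_mult_vec:
  fixes A :: "complex mat"
  assumes A: "A \<in> carrier_mat n n" and x: "x \<in> carrier_vec n"
  shows "A ^\<^sub>m Suc k *\<^sub>v x = A *\<^sub>v (A ^\<^sub>m k *\<^sub>v x)"
  using x
proof (induction k arbitrary: x)
  case (Suc k)
  have c: "A ^\<^sub>m k \<in> carrier_mat n n" "A ^\<^sub>m Suc k \<in> carrier_mat n n" using A by auto
  have "A ^\<^sub>m Suc (Suc k) *\<^sub>v x = A ^\<^sub>m Suc k *\<^sub>v (A *\<^sub>v x)"
    using assoc_mult_mat_vec[OF c(2) A Suc.prems] by simp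
  also have "\<dots> = A *\<^sub>v (A ^\<^sub>m k *\<^sub>v (A *\<^sub>v x))" using Suc.IH[of "A *\<^sub>v x"] A Suc.prems by simp
  also have "A ^\<^sub>m k *\<^sub>v (A *\<^sub>v x) = A ^\<^sub>m Suc k *\<^sub>v x"
    using assoc_mult_mat_vec[OF c(1) A Suc.prems] by simp
  finally show ?case .
qed (use A in auto)

lemma normal_mat_contraction:
  assumes A: "A \<in> carrier_mat n n" and N: "normal_mat A" and sr: "spectral_radius A < 1"
    and x: "x \<in> carrier_vec n"
  shows "vec_norm2 (A *\<^sub>v x) \<le> vec_norm2 x"
proof (rule ccontr)
  assume less: "\<not> vec_norm2 (A *\<^sub>v x) \<le> vec_norm2 x"
  define s where "s k = vec_norm2 (A ^\<^sub>m k *\<^sub>v x)" for k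
  have lc: "(s (Suc k))\<^sup>2 \<le> s k * s (Suc (Suc k))" for k
    unfolding s_def pow_mat_Suc_mult_vec[OF A x] using A x
    by (intro normal_mat_log_convex[OF A N]) (metis mult_mat_vec_carrier pow_carrier_mat)
  have s0: "s 0 = vec_norm2 x" and s1: "s 1 = vec_norm2 (A *\<^sub>v x)" using A x by (auto simp: s_def)
  have "s 0 \<noteq> 0"
  proof
    assume "s 0 = 0"
    then have "(s 1)\<^sup>2 \<le> 0" using lc[of 0] by simp
    then show False using less \<open>s 0 = 0\<close> s0 s1 by simp
  qed
  then have pos: "0 < s 0" "s 0 < s 1" using less s0 s1 by (auto simp: s_def order_less_le)
  define \<rho> where "\<rho> = s 1 / s 0"
  have grow: "\<rho> ^ k * s 0 \<le> s k" for k
    using log_convex_growth[of s k] lc pos by (simp add: s_def \<rho>_def)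
  \<comment> \<open>One constant bounds the entries of all powers at once; this comes from the
    Jordan normal form and the spectral radius being below 1.\<close>
  obtain b where b: "norm_bound (A ^\<^sub>m k) b" for k
    using spectral_radius_jnf_norm_bound_less_1_upper_triangular[OF A sr] by blast
  define C where "C = real n * (b * (\<Sum>j = 0..<n. cmod (x $ j)))"
  have bd: "s k \<le> C" for k
    unfolding s_def C_def using A by (intro norm_bound_mult_vec b x) auto
  have "\<rho> > 1" using pos by (simp add: \<rho>_def)
  then obtain k where "C / s 0 < \<rho> ^ k" using real_arch_pow by blast
  then have "C < \<rho> ^ k * s 0" using pos by (simp add: divide_less_eq)
  with grow[of k] bd[of k] show False by simp
qed

section \<open>Shifting and scaling: discs containing the spectrum\<close>

lemma affine_mult_vec:
  fixes A :: "complex mat"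
  assumes A: "A \<in> carrier_mat n n" and v: "v \<in> carrier_vec n"
  shows "(k \<cdot>\<^sub>m (A - c \<cdot>\<^sub>m 1\<^sub>m n)) *\<^sub>v v = k \<cdot>\<^sub>v (A *\<^sub>v v - c \<cdot>\<^sub>v v)"
proof -
  have smult: "(l \<cdot>\<^sub>m M) *\<^sub>v v = l \<cdot>\<^sub>v (M *\<^sub>v v)" if "M \<in> carrier_mat n n" for l M
    using that v by (intro eq_vecI) auto
  have "(A - c \<cdot>\<^sub>m 1\<^sub>m n) *\<^sub>v v = A *\<^sub>v v - c \<cdot>\<^sub>v v"
    using minus_mult_distrib_mat_vec[OF A _ v, of "c \<cdot>\<^sub>m 1\<^sub>m n"] smult[of "1\<^sub>m n" c] v by simp
  moreover have "A - c \<cdot>\<^sub>m 1\<^sub>m n \<in> carrier_mat n n" by (simp add: minus_carrier_mat)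
  ultimately show ?thesis using smult by simp
qed

text \<open>Expanding both products with the adjoint, the terms linear in \<open>A\<close>, its
  adjoint and the identity match, and the quadratic ones agree by normality of
  \<open>A\<close>.\<close>

lemma normal_mat_affine:
  assumes A: "A \<in> carrier_mat n n" and N: "normal_mat A"
  shows "normal_mat (k \<cdot>\<^sub>m (A - c \<cdot>\<^sub>m 1\<^sub>m n))"
proof -
  let ?A = "mat_adjoint A" and ?I = "1\<^sub>m n :: complex mat"
  have A': "?A \<in> carrier_mat n n" using A by simp
  have adj: "mat_adjoint (k \<cdot>\<^sub>m (A - c \<cdot>\<^sub>m ?I)) = cnj k \<cdot>\<^sub>m (?A - cnj c \<cdot>\<^sub>m ?I)"
    using A by (intro eq_matI) auto
  have ss: "a \<cdot>\<^sub>m (b \<cdot>\<^sub>m M) = (a * b) \<cdot>\<^sub>m M" for a b and M :: "complex mat"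
    by (intro eq_matI) auto
  have expand: "(X - a \<cdot>\<^sub>m ?I) * (Y - b \<cdot>\<^sub>m ?I)
      = (X * Y - b \<cdot>\<^sub>m X) - (a \<cdot>\<^sub>m Y - (a * b) \<cdot>\<^sub>m ?I)"
    if X: "X \<in> carrier_mat n n" and Y: "Y \<in> carrier_mat n n" for X Y a b
  proof -
    have I: "a \<cdot>\<^sub>m ?I \<in> carrier_mat n n" "b \<cdot>\<^sub>m ?I \<in> carrier_mat n n" by auto
    have "(X - a \<cdot>\<^sub>m ?I) * (Y - b \<cdot>\<^sub>m ?I) = X * (Y - b \<cdot>\<^sub>m ?I) - a \<cdot>\<^sub>m ?I * (Y - b \<cdot>\<^sub>m ?I)"
      by (rule minus_mult_distrib_mat[OF X I(1) minus_carrier_mat[OF I(2)]])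
    also have "X * (Y - b \<cdot>\<^sub>m ?I) = X * Y - b \<cdot>\<^sub>m X"
      unfolding mult_minus_distrib_mat[OF X Y I(2)] using mult_smult_distrib[OF X one_carrier_mat] X by simp
    also have "a \<cdot>\<^sub>m ?I * (Y - b \<cdot>\<^sub>m ?I) = a \<cdot>\<^sub>m Y - (a * b) \<cdot>\<^sub>m ?I"
      unfolding mult_minus_distrib_mat[OF I(1) Y I(2)]
      using mult_smult_assoc_mat[OF one_carrier_mat Y] mult_smult_assoc_mat[OF one_carrier_mat I(2)] Y
      by (simp add: ss)
    finally show ?thesis .
  qed
  have "(?A * A - c \<cdot>\<^sub>m ?A) - (cnj c \<cdot>\<^sub>m A - (cnj c * c) \<cdot>\<^sub>m ?I)
      = (A * ?A - cnj c \<cdot>\<^sub>m A) - (c \<cdot>\<^sub>m ?A - (c * cnj c) \<cdot>\<^sub>m ?I)"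
    unfolding N[unfolded normal_mat_def] using A by (intro eq_matI) (auto simp: mult.commute)
  then have eq: "(?A - cnj c \<cdot>\<^sub>m ?I) * (A - c \<cdot>\<^sub>m ?I) = (A - c \<cdot>\<^sub>m ?I) * (?A - cnj c \<cdot>\<^sub>m ?I)"
    by (simp only: expand[OF A' A] expand[OF A A'])
  have smult: "a \<cdot>\<^sub>m X * (b \<cdot>\<^sub>m Y) = (a * b) \<cdot>\<^sub>m (X * Y)"
    if X: "X \<in> carrier_mat n n" and Y: "Y \<in> carrier_mat n n" for X Y :: "complex mat" and a b
    using mult_smult_assoc_mat[OF X smult_carrier_mat[OF Y]] mult_smult_distrib[OF X Y]
    by (simp add: ss)
  have c: "A - c \<cdot>\<^sub>m ?I \<in> carrier_mat n n" "?A - cnj c \<cdot>\<^sub>m ?I \<in> carrier_mat n n"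
    by (simp_all add: minus_carrier_mat)
  show ?thesis unfolding normal_mat_def adj smult[OF c] smult[OF c(2,1)] eq by (simp add: mult.commute)
qed

text \<open>An eigenvector of the rescaled matrix is one of \<open>A\<close>. This turns a disc
  around \<open>c\<close> into a bound on the spectral radius after rescaling.\<close>

lemma spectrum_affine:
  fixes A :: "complex mat"
  assumes A: "A \<in> carrier_mat n n" and k: "k \<noteq> 0"
    and \<mu>: "\<mu> \<in> spectrum (k \<cdot>\<^sub>m (A - c \<cdot>\<^sub>m 1\<^sub>m n))"
  shows "\<mu> / k + c \<in> spectrum A"
proof -
  obtain v where v: "v \<in> carrier_vec n" "v \<noteq> 0\<^sub>v n" "k \<cdot>\<^sub>v (A *\<^sub>v v - c \<cdot>\<^sub>v v) = \<mu> \<cdot>\<^sub>v v"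
    using \<mu> A affine_mult_vec[OF A] by (auto simp: spectrum_def eigenvalue_def eigenvector_def)
  have "A *\<^sub>v v = (\<mu> / k + c) \<cdot>\<^sub>v v"
  proof (rule eq_vecI)
    fix i assume i: "i < dim_vec ((\<mu> / k + c) \<cdot>\<^sub>v v)"
    have "(k \<cdot>\<^sub>v (A *\<^sub>v v - c \<cdot>\<^sub>v v)) $ i = (\<mu> \<cdot>\<^sub>v v) $ i" by (simp only: v(3))
    then have "k * ((A *\<^sub>v v) $ i - c * v $ i) = \<mu> * v $ i" using i A v(1) by simp
    then show "(A *\<^sub>v v) $ i = ((\<mu> / k + c) \<cdot>\<^sub>v v) $ i"
      using i k v(1) by (simp add: field_simps)
  qed (use A v in auto)
  then show ?thesis using A v by (auto simp: spectrum_def eigenvalue_def eigenvector_def)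
qed

text \<open>For \<rho> > R the matrix (A - c) / \<rho> is normal with spectral radius below 1, hence
  a contraction; then \<rho> decreases to \<open>R\<close>.\<close>

lemma normal_mat_spectrum_disc:
  assumes A: "A \<in> carrier_mat n n" and N: "normal_mat A" and n: "n > 0"
    and sp: "\<And>x. x \<in> spectrum A \<Longrightarrow> dist x c \<le> R" and v: "v \<in> carrier_vec n"
  shows "vec_norm2 (A *\<^sub>v v - c \<cdot>\<^sub>v v) \<le> R * vec_norm2 v"
proof -
  have R0: "0 \<le> R" using spectrum_non_empty[OF A n] sp zero_le_dist order_trans by blast
  have bound: "vec_norm2 (A *\<^sub>v v - c \<cdot>\<^sub>v v) \<le> \<rho> * vec_norm2 v" if "R < \<rho>" for \<rho>
  proof -
    have \<rho>: "\<rho> > 0" using that R0 by simp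
    let ?k = "of_real (1 / \<rho>) :: complex"
    let ?B = "?k \<cdot>\<^sub>m (A - c \<cdot>\<^sub>m 1\<^sub>m n)"
    have B: "?B \<in> carrier_mat n n" by (simp add: minus_carrier_mat)
    have "spectral_radius ?B < 1"
    proof -
      obtain \<mu> where \<mu>: "\<mu> \<in> spectrum ?B" "spectral_radius ?B = cmod \<mu>"
        using spectral_radius_mem_max(1)[OF B n] by auto
      have "dist (\<mu> / ?k + c) c \<le> R" using \<rho> by (intro sp spectrum_affine[OF A _ \<mu>(1)]) simp
      then have "cmod \<mu> * \<rho> \<le> R" using \<rho> by (simp add: dist_norm norm_mult)
      then have "cmod \<mu> * \<rho> < 1 * \<rho>" using that by simp
      then show ?thesis using \<rho> \<mu>(2) by simp
    qed
    then have "vec_norm2 (?B *\<^sub>v v) \<le> vec_norm2 v"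
      by (rule normal_mat_contraction[OF B normal_mat_affine[OF A N] _ v])
    then show ?thesis unfolding affine_mult_vec[OF A v] vec_norm2_smult
      using \<rho> by (simp add: field_simps norm_divide)
  qed
  show ?thesis
  proof (cases "vec_norm2 v = 0")
    case True then show ?thesis using bound[of "R + 1"] by simp
  next
    case False
    then have p: "0 < vec_norm2 v" using vec_norm2_nonneg[of v] by linarith
    \<comment> \<open>\<open>dense_ge\<close> performs the limit, after division by the positive
      norm of \<open>v\<close>.\<close>
    have "vec_norm2 (A *\<^sub>v v - c \<cdot>\<^sub>v v) / vec_norm2 v \<le> R"
      by (rule dense_ge) (use bound p in \<open>simp add: divide_le_eq\<close>)
    then show ?thesis using p by (simp add: divide_le_eq)
  qed
qed

text \<open>For a unit vector \<open>c\<close> equals the inner product of c * v with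
  \<open>v\<close>, so Cauchy-Schwarz reduces the claim to the previous norm bound.\<close>

lemma normal_mat_numerical_range_disc:
  assumes A: "A \<in> carrier_mat n n" and N: "normal_mat A" and n: "n > 0"
    and sp: "\<And>x. x \<in> spectrum A \<Longrightarrow> dist x c \<le> R"
    and v: "v \<in> carrier_vec n" "v \<bullet>c v = 1"
  shows "dist ((A *\<^sub>v v) \<bullet>c v) c \<le> R"
proof -
  have v1: "vec_norm2 v = 1"
    using v(2) vec_norm2_nonneg[of v] unfolding cscalar_prod_self of_real_eq_1_iff power2_eq_1_iff
    by linarith
  have "(A *\<^sub>v v) \<bullet>c v - c = (A *\<^sub>v v - c \<cdot>\<^sub>v v) \<bullet>c v"
    using A v by (subst minus_scalar_prod_distrib[of _ n]) auto
  also have "cmod \<dots> \<le> vec_norm2 (A *\<^sub>v v - c \<cdot>\<^sub>v v) * vec_norm2 v"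
    using A v by (intro cscalar_prod_Cauchy_Schwarz) simp
  finally show ?thesis
    using normal_mat_spectrum_disc[OF A N n sp v(1)] v1 by (simp add: dist_norm)
qed

lemma hermitian_mat_spectrum_real:
  assumes A: "A \<in> carrier_mat n n" and H: "hermitian_mat A" and \<mu>: "\<mu> \<in> spectrum A"
  shows "\<mu> \<in> \<real>"
proof -
  obtain v where v: "v \<in> carrier_vec n" "v \<noteq> 0\<^sub>v n" "A *\<^sub>v v = \<mu> \<cdot>\<^sub>v v"
    using \<mu> A by (auto simp: spectrum_def eigenvalue_def eigenvector_def)
  have "(A *\<^sub>v v) \<bullet>c v = v \<bullet>c (A *\<^sub>v v)"
    using cscalar_prod_adjoint[OF A v(1) v(1)] H by (simp add: hermitian_mat_def)
  then have "\<mu> * (v \<bullet>c v) = cnj \<mu> * (v \<bullet>c v)"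
    using v by (simp add: conjugate_smult_vec)
  moreover have "v \<bullet>c v \<noteq> 0" using v by simp
  ultimately show ?thesis by (simp add: Reals_cnj_iff)
qed

section \<open>Diagonal entries and the spread\<close>

text \<open>The one-dimensional counterpart of Jung's theorem; the centre is the midpoint of the
  extreme points.\<close>

lemma real_subset_disc:
  fixes S :: "complex set"
  assumes "finite S" "S \<subseteq> \<real>" and d: "\<And>x y. x \<in> S \<Longrightarrow> y \<in> S \<Longrightarrow> dist x y \<le> d"
  obtains c where "\<And>x. x \<in> S \<Longrightarrow> dist x c \<le> d / 2"
proof (cases "S = {}")
  case False
  define T where "T = Re ` S"
  have T: "finite T" "T \<noteq> {}" using assms(1) False by (auto simp: T_def)
  have S: "S = of_real ` T"
    using assms(2) by (force simp: T_def image_image of_real_Re)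
  then have "of_real (Max T) \<in> S" "of_real (Min T) \<in> S" using T by auto
  then have "dist (of_real (Max T) :: complex) (of_real (Min T)) \<le> d" by (rule d)
  then have MM: "Max T - Min T \<le> d"
    by (simp add: dist_norm flip: of_real_diff)
  show ?thesis
  proof (rule that)
    fix x assume "x \<in> S"
    then obtain t where t: "t \<in> T" "x = of_real t" using S by auto
    have "Min T \<le> t" "t \<le> Max T" using T t by auto
    then have "\<bar>t - (Min T + Max T) / 2\<bar> \<le> d / 2" using MM by (simp add: abs_le_iff field_simps)
    then show "dist x (of_real ((Min T + Max T) / 2)) \<le> d / 2"
      unfolding t(2) dist_norm of_real_diff[symmetric] norm_of_real .
  qed
qed (use that in auto)

lemma dist_spectrum_le_spread:
  assumes A: "A \<in> carrier_mat n n" and "x \<in> spectrum A" "y \<in> spectrum A"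
  shows "dist x y \<le> spread A"
  unfolding spread_def dist_norm
proof (rule Max_ge)
  \<comment> \<open>Writing the differences as an image of pairs gives the finiteness that
    \<open>Max_ge\<close> requires.\<close>
  have "{cmod (x - y) | x y. x \<in> spectrum A \<and> y \<in> spectrum A}
      = (\<lambda>(x, y). cmod (x - y)) ` (spectrum A \<times> spectrum A)" by auto
  then show "finite {cmod (x - y) | x y. x \<in> spectrum A \<and> y \<in> spectrum A}"
    using card_finite_spectrum(1)[OF A] by simp
qed (use assms in blast)

lemma orthonormal_basis_carrier:
  assumes "orthonormal_basis n e" "i < n"
  shows "e i \<in> carrier_vec n"
  using assms vectorspace.basis_def[OF vec_vs, of n "e ` {..<n}"]
  by (auto simp: orthonormal_basis_def module_vec_simps)

text \<open>Common source of both inequalities, which differ only in the radius: the diagonal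
  entries lie in every disc that contains the spectrum.\<close>

lemma diag_deviation_le_disc:
  assumes n: "n \<ge> 1" and p: "1 \<le> p" and e: "orthonormal_basis n e"
    and A: "A \<in> carrier_mat n n" and N: "normal_mat A"
    and sp: "\<And>x. x \<in> spectrum A \<Longrightarrow> dist x c \<le> R"
  shows "diag_deviation n p A e \<le> 2 * R * bernoulli_moment_max p powr (1 / p)"
proof -
  define z where "z i = (A *\<^sub>v e i) \<bullet>c e i" for i
  have z: "dist (z i) c \<le> R" if "i \<in> {..<n}" for i
    unfolding z_def
    by (rule normal_mat_numerical_range_disc[OF A N _ sp])
      (use n e that orthonormal_basis_carrier in \<open>auto simp: orthonormal_basis_def\<close>)
  have ne: "{..<n} \<noteq> {}" using n by (auto simp: lessThan_empty_iff)
  have "diag_mean n A e = (\<Sum>i<n. z i) / of_nat (card {..<n})"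
    by (simp add: diag_mean_def z_def)
  from disc_central_moment[OF finite_lessThan ne z p this] show ?thesis
    by (simp add: diag_deviation_def z_def)
qed

theorem corollary3:
  fixes n :: nat and p :: real and e :: "nat \<Rightarrow> complex vec" and A :: "complex mat"
  assumes "n \<ge> 1" and "1 \<le> p"
    and "orthonormal_basis n e"
    and "A \<in> carrier_mat n n" and "normal_mat A"
  shows "diag_deviation n p A e
           \<le> 2 / sqrt 3 * bernoulli_moment_max p powr (1 / p) * spread A \<and>
         (hermitian_mat A \<longrightarrow>
           diag_deviation n p A e \<le> bernoulli_moment_max p powr (1 / p) * spread A)"
proof -
  note dev = diag_deviation_le_disc[OF assms]
  note fin = card_finite_spectrum(1)[OF assms(4)]
  note spd = dist_spectrum_le_spread[OF assms(4)]
  obtain c where "\<And>x. x \<in> spectrum A \<Longrightarrow> dist x c \<le> spread A / sqrt 3"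
    using jung_complex[OF fin spd] by blast
  from dev[OF this] have "diag_deviation n p A e
      \<le> 2 / sqrt 3 * bernoulli_moment_max p powr (1 / p) * spread A"
    by (simp add: field_simps)
  moreover have "diag_deviation n p A e \<le> bernoulli_moment_max p powr (1 / p) * spread A"
    if H: "hermitian_mat A"
  proof -
    have "spectrum A \<subseteq> \<real>" using hermitian_mat_spectrum_real[OF assms(4) H] by blast
    then obtain c where "\<And>x. x \<in> spectrum A \<Longrightarrow> dist x c \<le> spread A / 2"
      using real_subset_disc[OF fin _ spd] by blast
    from dev[OF this] show ?thesis by (simp add: mult.commute)
  qed
  ultimately show ?thesis by blast
qed

end
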